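(* We have $\displaystyle\lim_{K\to\infty}\alpha_K=\frac1{\ln 2}$.
   Context: For $K\in\mathbb{N}$ let $p_1<\dots<p_K$ be the order statistics of $K$ independent random variables uniformly distributed on $[0,1]$, and define the spacings $D_0=p_1$, $D_i=p_{i+1}-p_i$ for $1\le i\le K-1$, $D_K=1-p_K$, $D=(D_0,\dots,D_K)$. Let $\mathcal{T}$ be the (finite) set of all binary search trees with internal nodes $p_1,\dots,p_K$ and external nodes (leaves) $S_0,\dots,S_K$ from left to right (i.e. all full binary trees with $K$ internal nodes and $K+1$ leaves). For $t\in\mathcal{T}$ let $h_t(i)$ be the depth of the leaf $S_i$ in $t$ (the root having depth $0$), and $l_t(x_0,\dots,x_K)=\sum_{i=0}^K x_i h_t(i)$. Put $l_{\mathrm{opt}}(D)=\min_{t\in\mathcal{T}}l_t(D)$, $\gamma_K=\mathbb{E}[l_{\mathrm{opt}}(D)]$, and $\alpha_K=\gamma_K/(H_{K+1}-1)$, where $H_n=\sum_{i=1}^n\frac1i$. *)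

theory Defs
  imports "HOL-Probability.Probability" "HOL-Library.Tree"
begin

text \<open>
  \<open>order_stat K X \<omega> i\<close> is the \<open>i\<close>-th smallest of \<open>X 1 \<omega>, \<dots>, X K \<omega>\<close>; it is meaningful for
  \<open>1 \<le> i \<le> K\<close> only.
\<close>

definition order_stat :: "nat \<Rightarrow> (nat \<Rightarrow> 'a \<Rightarrow> real) \<Rightarrow> 'a \<Rightarrow> nat \<Rightarrow> real" where
  "order_stat K X \<omega> i = sort (map (\<lambda>j. X j \<omega>) [1..<Suc K]) ! (i - 1)"

text \<open>
  The end points \<open>0\<close> and \<open>1\<close> take the place of the missing \<open>p 0\<close> and \<open>p (K + 1)\<close>, so that
  \<open>D 0 = p 1\<close>, \<open>D i = p (i + 1) - p i\<close> for \<open>1 \<le> i < K\<close>, and \<open>D K = 1 - p K\<close>.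
\<close>

definition spacing :: "nat \<Rightarrow> (nat \<Rightarrow> real) \<Rightarrow> nat \<Rightarrow> real" where
  "spacing K p i = (if i = K then 1 else p (i + 1)) - (if i = 0 then 0 else p i)"

text \<open>
  The internal node \<open>p i\<close> is represented by its index \<open>i\<close>; almost surely \<open>p\<close> is strictly
  increasing, so the search trees on the keys \<open>p 1, \<dots>, p K\<close> are those on \<open>1, \<dots>, K\<close>.  The
  predicate \<^const>\<open>bst\<close> is strict, so each key occurs exactly once.
  The external nodes are the occurrences of \<^const>\<open>Leaf\<close>.
\<close>

definition search_trees :: "nat \<Rightarrow> nat tree set" where
  "search_trees K = {t. bst t \<and> set_tree t = {1..K}}"

text \<open>The depths of the leaves, listed from left to right.\<close>

fun leaf_depths :: "'a tree \<Rightarrow> nat list" where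
  "leaf_depths Leaf = [0]"
| "leaf_depths (Node l a r) = map Suc (leaf_depths l @ leaf_depths r)"

definition leaf_depth :: "'a tree \<Rightarrow> nat \<Rightarrow> nat" where
  "leaf_depth t i = leaf_depths t ! i"

definition path_length :: "nat \<Rightarrow> 'a tree \<Rightarrow> (nat \<Rightarrow> real) \<Rightarrow> real" where
  "path_length K t x = (\<Sum>i=0..K. x i * real (leaf_depth t i))"

definition opt_path_length :: "nat \<Rightarrow> (nat \<Rightarrow> real) \<Rightarrow> real" where
  "opt_path_length K x = Min ((\<lambda>t. path_length K t x) ` search_trees K)"

definition gamma_opt :: "'a measure \<Rightarrow> (nat \<Rightarrow> 'a \<Rightarrow> real) \<Rightarrow> nat \<Rightarrow> real" where
  "gamma_opt M X K = (\<integral>\<omega>. opt_path_length K (spacing K (order_stat K X \<omega>)) \<partial>M)"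

text \<open>For \<open>K = 0\<close> the denominator vanishes; this value is irrelevant to the limit.\<close>

definition alpha_opt :: "'a measure \<Rightarrow> (nat \<Rightarrow> 'a \<Rightarrow> real) \<Rightarrow> nat \<Rightarrow> real" where
  "alpha_opt M X K = gamma_opt M X K / (harm (K + 1) - 1)"

text \<open>Leaf indices and the minimum are well defined.\<close>

lemma size_search_trees:
  assumes "t \<in> search_trees K"
  shows "size t = K"
proof -
  have "distinct (inorder t)"
    using assms by (simp add: search_trees_def bst_iff_sorted_wrt_less strict_sorted_iff)
  then have "length (inorder t) = card (set_tree t)"
    by (metis distinct_card set_inorder)
  then show ?thesis using assms by (simp add: search_trees_def)
qed

lemma length_leaf_depths: "length (leaf_depths t) = size t + 1"
  by (induction t) auto

lemma finite_search_trees: "finite (search_trees K)"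
proof -
  have "finite {t. set_tree t \<subseteq> {1..K} \<and> size t \<le> n}" for n
  proof (induction n)
    case 0
    have "{t :: nat tree. set_tree t \<subseteq> {1..K} \<and> size t \<le> 0} \<subseteq> {Leaf}" by auto
    then show ?case by (rule finite_subset) simp
  next
    case (Suc n)
    let ?A = "{t. set_tree t \<subseteq> {1..K} \<and> size t \<le> n}"
    have "{t. set_tree t \<subseteq> {1..K} \<and> size t \<le> Suc n}
      \<subseteq> insert Leaf ((\<lambda>(l, a, r). Node l a r) ` (?A \<times> {1..K} \<times> ?A))"
    proof
      fix t assume "t \<in> {t. set_tree t \<subseteq> {1..K} \<and> size t \<le> Suc n}"
      then show "t \<in> insert Leaf ((\<lambda>(l, a, r). Node l a r) ` (?A \<times> {1..K} \<times> ?A))"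
        by (cases t) (auto simp: image_iff)
    qed
    moreover have "finite (insert Leaf ((\<lambda>(l, a, r). Node l a r) ` (?A \<times> {1..K} \<times> ?A)))"
      using Suc by (intro finite.insertI finite_imageI finite_cartesian_product) simp_all
    ultimately show ?case by (rule finite_subset)
  qed
  moreover have "search_trees K \<subseteq> {t. set_tree t \<subseteq> {1..K} \<and> size t \<le> K}"
    using size_search_trees by (auto simp: search_trees_def)
  ultimately show ?thesis by (metis finite_subset)
qed

lemma search_trees_nonempty: "search_trees K \<noteq> {}"
proof (induction K)
  case 0
  have "Leaf \<in> search_trees 0" by (simp add: search_trees_def)
  then show ?case by blast
next
  case (Suc K)
  then obtain t where "t \<in> search_trees K" by blast
  then have "Node t (Suc K) Leaf \<in> search_trees (Suc K)"
    by (auto simp: search_trees_def)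
  then show ?case by blast
qed

end

theory Submission
  imports Defs
begin

text \<open>
  The upper bound comes from a balanced tree, whose leaves all have depth at most
  \<open>log 2 (K + 1) + 1\<close>.  For the lower bound, Kraft's equality \<open>\<Sum>i. 2 ^ - h i = 1\<close> and two
  applications of \<open>ln y \<le> y - 1\<close> give, for every \<open>a > 0\<close> and every tree,
  \<open>ln 2 * (\<Sum>i. D i * h i) \<ge> ln a + 1 - a * (\<Sum>i. (D i)\<^sup>2)\<close>.  The sum of the squared spacings is the
  area of the set of pairs \<open>(u, v)\<close> in the unit square that no sample point separates, so by
  Tonelli its expectation is at most \<open>\<integral>\<integral> (1 - \<bar>u - v\<bar>) ^ K du dv \<le> 2 / (K + 1)\<close>; take
  \<open>a = (K + 1) / 2\<close>.  Both bounds are \<open>ln K / ln 2 + O(1)\<close>.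
\<close>

section \<open>Deterministic bounds on the weighted path length\<close>

text \<open>Hanging two subtrees under a root raises every depth by one, so each of their sums is
  halved.\<close>

lemma leaf_depths_Kraft: "(\<Sum>d\<leftarrow>leaf_depths t. (1/2::real) ^ d) = 1"
proof (induction t)
  case (Node l a r)
  have "(\<Sum>d\<leftarrow>leaf_depths (Node l a r). (1/2::real) ^ d)
      = (1/2) * (\<Sum>d\<leftarrow>leaf_depths l. (1/2) ^ d) + (1/2) * (\<Sum>d\<leftarrow>leaf_depths r. (1/2) ^ d)"
    by (simp add: o_def sum_list_const_mult[symmetric])
  with Node show ?case by simp
qed simp

lemma leaf_depths_le_height: "d \<in> set (leaf_depths t) \<Longrightarrow> d \<le> height t"
  by (induction t arbitrary: d) (auto simp: le_max_iff_disj)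

text \<open>By Gibbs' inequality against the Kraft weights, \<open>ln 2\<close> times the path
  length is at least the entropy of \<open>x\<close>. The entropy is then bounded below by a
  quadratic expression in \<open>x\<close>, so that only second moments of the spacings have to be
  controlled.\<close>

lemma path_length_ge:
  fixes x :: "nat \<Rightarrow> real"
  assumes t: "t \<in> search_trees K" and x: "\<And>i. i \<le> K \<Longrightarrow> 0 \<le> x i"
    and sum: "(\<Sum>i=0..K. x i) = 1" and a: "0 < a"
  shows "ln a + 1 - a * (\<Sum>i=0..K. (x i)\<^sup>2) \<le> ln 2 * path_length K t x"
proof -
  define h where "h i = leaf_depth t i" for i
  have len: "length (leaf_depths t) = Suc K"
    using t by (simp add: length_leaf_depths size_search_trees)
  have "(\<Sum>i=0..K. (1/2::real) ^ h i) = (\<Sum>d\<leftarrow>leaf_depths t. (1/2) ^ d)"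
    by (simp add: sum_list_sum_nth len h_def leaf_depth_def atLeastLessThanSuc_atLeastAtMost del: One_nat_def)
  then have kraft: "(\<Sum>i=0..K. (1/2::real) ^ h i) = 1"
    by (simp add: leaf_depths_Kraft)
  have "x i * ln a + 2 * x i - (1/2) ^ h i - a * (x i)\<^sup>2 \<le> ln 2 * (x i * real (h i))"
    \<comment> \<open>For \<open>x i = 0\<close> the claim is just that minus the Kraft weight is at
      most 0; the other case divides by \<open>x i\<close>.\<close>
    if "i \<le> K" for i
  proof (cases "x i = 0")
    case False
    with x[OF that] have pos: "0 < x i" by simp
    have "ln ((1/2) ^ h i / x i) \<le> (1/2) ^ h i / x i - 1"
      using pos by (intro ln_le_minus_one) simp
    moreover have "ln ((1/2) ^ h i / x i) = - real (h i) * ln 2 - ln (x i)"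
      using pos by (simp add: ln_div ln_realpow)
    \<comment> \<open>This is the tangent to \<open>ln\<close> at \<open>x i = 1 / a\<close>, which
      replaces the entropy term by a linear one.\<close>
    moreover have "ln (a * x i) \<le> a * x i - 1"
      using pos a by (intro ln_le_minus_one) simp
    moreover have "ln (a * x i) = ln a + ln (x i)"
      using pos a by (simp add: ln_mult)
    ultimately have "ln a + 2 - (1/2) ^ h i / x i - a * x i \<le> ln 2 * real (h i)"
      by (simp add: mult.commute)
    then have "x i * (ln a + 2 - (1/2) ^ h i / x i - a * x i) \<le> x i * (ln 2 * real (h i))"
      using pos by simp
    then show ?thesis
      using pos by (simp add: algebra_simps power2_eq_square)
  qed simp
  then have "(\<Sum>i=0..K. x i * ln a + 2 * x i - (1/2) ^ h i - a * (x i)\<^sup>2)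
      \<le> (\<Sum>i=0..K. ln 2 * (x i * real (h i)))"
    by (intro sum_mono) simp
  \<comment> \<open>The constant is 2 - 1 = 1: total mass 1 of \<open>x\<close>, counted twice,
    minus Kraft's sum.\<close>
  moreover have "(\<Sum>i=0..K. x i * ln a + 2 * x i - (1/2) ^ h i - a * (x i)\<^sup>2)
      = ln a + 1 - a * (\<Sum>i=0..K. (x i)\<^sup>2)"
    using sum kraft
    by (simp add: sum.distrib sum_subtractf sum_distrib_left[symmetric] sum_distrib_right[symmetric])
  ultimately show ?thesis
    by (simp add: path_length_def h_def sum_distrib_left)
qed

lemma opt_path_length_ge:
  fixes x :: "nat \<Rightarrow> real"
  assumes "\<And>i. i \<le> K \<Longrightarrow> 0 \<le> x i" "(\<Sum>i=0..K. x i) = 1" "0 < a"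
  shows "ln a + 1 - a * (\<Sum>i=0..K. (x i)\<^sup>2) \<le> ln 2 * opt_path_length K x"
proof -
  have "opt_path_length K x \<in> (\<lambda>t. path_length K t x) ` search_trees K"
    unfolding opt_path_length_def
    using finite_search_trees search_trees_nonempty by (intro Min_in) auto
  then show ?thesis using path_length_ge[OF _ assms] by auto
qed

lemma opt_path_length_nonneg:
  assumes "\<And>i. i \<le> K \<Longrightarrow> 0 \<le> x i"
  shows "0 \<le> opt_path_length K x"
  unfolding opt_path_length_def path_length_def
  using assms finite_search_trees search_trees_nonempty
  by (subst Min_ge_iff) (auto intro!: sum_nonneg)

text \<open>Induction with a middle key as root. The offset \<open>a\<close> is general because the
  keys of the right subtree do not start at 1.\<close>

lemma ex_bst_height_le:
  "n < 2 ^ h \<Longrightarrow> \<exists>t. bst t \<and> set_tree t = {Suc a..a + n} \<and> height t \<le> h"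
proof (induction h arbitrary: n a)
  case 0
  then show ?case by (intro exI[of _ Leaf]) auto
next
  case (Suc h)
  show ?case
  proof (cases "n = 0")
    case True
    then show ?thesis by (intro exI[of _ Leaf]) auto
  next
    case False
    \<comment> \<open>The left subtree receives \<open>m\<close> keys and the right one
      \<open>n - m - 1\<close>; both numbers are at most \<open>n div 2\<close>, hence below
      \<open>2 ^ h\<close>.\<close>
    define m where "m = n div 2"
    have m: "m < n" "m < 2 ^ h" "n - m - 1 < 2 ^ h"
      using False Suc.prems by (auto simp: m_def)
    obtain l where l: "bst l" "set_tree l = {Suc a..a + m}" "height l \<le> h"
      using Suc.IH[OF m(2)] by blast
    obtain r where r: "bst r" "set_tree r = {Suc (Suc (a + m))..Suc (a + m) + (n - m - 1)}" "height r \<le> h"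
      using Suc.IH[OF m(3)] by blast
    show ?thesis
      using l r m by (intro exI[of _ "Node l (Suc (a + m)) r"]) auto
  qed
qed

text \<open>The path length of a tree is a convex combination of its leaf depths, so it is at most
  the height; a balanced tree serves as competitor in the minimum.\<close>

lemma opt_path_length_le:
  fixes x :: "nat \<Rightarrow> real"
  assumes x: "\<And>i. i \<le> K \<Longrightarrow> 0 \<le> x i" and sum: "(\<Sum>i=0..K. x i) = 1" and K: "K < 2 ^ h"
  shows "opt_path_length K x \<le> real h"
proof -
  obtain t where t: "t \<in> search_trees K" "height t \<le> h"
    using ex_bst_height_le[OF K, of 0] by (auto simp: search_trees_def)
  have "leaf_depth t i \<le> h" if "i \<le> K" for i
    using leaf_depths_le_height[of "leaf_depth t i" t] t that
    by (auto simp: leaf_depth_def length_leaf_depths size_search_trees)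
  then have "path_length K t x \<le> (\<Sum>i=0..K. x i * real h)"
    unfolding path_length_def using x by (intro sum_mono mult_left_mono) auto
  also have "\<dots> = real h"
    using sum by (simp add: sum_distrib_right[symmetric])
  finally have "path_length K t x \<le> real h" .
  moreover have "opt_path_length K x \<le> path_length K t x"
    unfolding opt_path_length_def using t finite_search_trees by (intro Min_le) auto
  ultimately show ?thesis by simp
qed

section \<open>Spacings and order statistics, and their measurability\<close>

text \<open>With the end points added as values at \<open>0\<close> and \<open>Suc K\<close>, every
  spacing is a difference of consecutive values, without case distinctions.\<close>

definition grid :: "nat \<Rightarrow> (nat \<Rightarrow> real) \<Rightarrow> nat \<Rightarrow> real" where
  "grid K p i = (if i = 0 then 0 else if i = Suc K then 1 else p i)"

lemma spacing_eq_grid: "i \<le> K \<Longrightarrow> spacing K p i = grid K p (Suc i) - grid K p i"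
  by (auto simp: spacing_def grid_def)

lemma sum_spacing: "(\<Sum>i=0..K. spacing K p i) = 1"
proof -
  have "(\<Sum>i=0..K. spacing K p i) = (\<Sum>i=0..K. grid K p (Suc i) - grid K p i)"
    by (intro sum.cong) (auto simp: spacing_eq_grid)
  also have "\<dots> = 1"
    by (subst sum_Suc_diff) (auto simp: grid_def)
  finally show ?thesis .
qed

lemma order_stat_mem:
  assumes "i \<in> {1..K}" shows "\<exists>j\<in>{1..K}. order_stat K X \<omega> i = X j \<omega>"
proof -
  have "order_stat K X \<omega> i \<in> set (sort (map (\<lambda>j. X j \<omega>) [1..<Suc K]))"
    unfolding order_stat_def using assms by (intro nth_mem) auto
  then show ?thesis by auto
qed

lemma order_stat_mono:
  assumes "1 \<le> i" "i \<le> j" "j \<le> K" shows "order_stat K X \<omega> i \<le> order_stat K X \<omega> j"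
  unfolding order_stat_def using assms by (intro sorted_nth_mono) auto

lemma order_stat_surj:
  assumes "j \<in> {1..K}" shows "\<exists>i\<in>{1..K}. X j \<omega> = order_stat K X \<omega> i"
proof -
  have "X j \<omega> \<in> set (sort (map (\<lambda>j. X j \<omega>) [1..<Suc K]))"
    using assms by (auto simp del: upt_Suc)
  then obtain i where "i < K" "sort (map (\<lambda>j. X j \<omega>) [1..<Suc K]) ! i = X j \<omega>"
    by (subst (asm) in_set_conv_nth) (auto simp del: upt_Suc)
  then show ?thesis
    by (intro bexI[of _ "Suc i"]) (auto simp: order_stat_def)
qed

lemma grid_order_stat_mono:
  assumes X: "\<And>j. j \<in> {1..K} \<Longrightarrow> X j \<omega> \<in> {0..1}" and "i \<le> j" "j \<le> Suc K"
  shows "grid K (order_stat K X \<omega>) i \<le> grid K (order_stat K X \<omega>) j"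
proof -
  have "order_stat K X \<omega> k \<in> {0..1}" if "k \<in> {1..K}" for k
    using order_stat_mem[OF that, of X \<omega>] X by auto
  then show ?thesis
    using assms(2,3) order_stat_mono[of i j K X \<omega>]
    by (auto simp: grid_def Suc_le_eq)
qed

text \<open>In a sorted list the entries at most \<open>y\<close> form a prefix, whose length is the
  number of such entries.\<close>

lemma sorted_nth_le_iff:
  "sorted xs \<Longrightarrow> i < length xs \<Longrightarrow> xs ! i \<le> y \<longleftrightarrow> i < length (filter (\<lambda>x. x \<le> y) xs)"
proof (induction xs arbitrary: i)
  case (Cons x xs)
  show ?case
  proof (cases "x \<le> y")
    case True
    with Cons show ?thesis by (cases i) auto
  next
    case False
    then have "\<not> z \<le> y" if "z \<in> set (x # xs)" for z
      using that Cons.prems(1) by auto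
    then have "filter (\<lambda>x. x \<le> y) (x # xs) = []" "\<not> (x # xs) ! i \<le> y"
      using Cons.prems(2) nth_mem[of i "x # xs"] by (auto simp: filter_empty_conv)
    then show ?thesis by simp
  qed
qed simp

text \<open>Counting the samples up to \<open>y\<close> avoids \<open>sort\<close>; the count is a
  finite sum of indicators, from which measurability is immediate.\<close>

lemma order_stat_le_iff:
  assumes "i \<in> {1..K}"
  shows "order_stat K X \<omega> i \<le> y \<longleftrightarrow> real i \<le> (\<Sum>j=1..K. indicator {..y} (X j \<omega>))"
proof -
  let ?xs = "map (\<lambda>j. X j \<omega>) [1..<Suc K]"
  have len: "real (length (filter (\<lambda>x. x \<le> y) (map f xs))) = (\<Sum>j\<leftarrow>xs. indicator {..y} (f j))"
    for f :: "nat \<Rightarrow> real" and xs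
    by (induction xs) (auto simp: indicator_def)
  have "length (filter (\<lambda>x. x \<le> y) (sort ?xs)) = length (filter (\<lambda>x. x \<le> y) ?xs)"
    by (metis mset_filter mset_sort size_mset)
  then have "order_stat K X \<omega> i \<le> y \<longleftrightarrow> i \<le> length (filter (\<lambda>x. x \<le> y) ?xs)"
    unfolding order_stat_def using assms by (subst sorted_nth_le_iff) auto
  also have "\<dots> \<longleftrightarrow> real i \<le> (\<Sum>j\<leftarrow>[1..<Suc K]. indicator {..y} (X j \<omega>))"
    by (subst len[symmetric]) (simp only: of_nat_le_iff)
  also have "(\<Sum>j\<leftarrow>[1..<Suc K]. indicator {..y} (X j \<omega>)) = (\<Sum>j=1..K. indicator {..y} (X j \<omega>) :: real)"
    by (subst sum_list_distinct_conv_sum_set) (auto simp: atLeastLessThanSuc_atLeastAtMost simp del: upt_Suc)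
  finally show ?thesis .
qed

lemma borel_measurable_order_stat:
  assumes [measurable]: "\<And>j. j \<in> {1..K} \<Longrightarrow> X j \<in> borel_measurable M" and i: "i \<in> {1..K}"
  shows "(\<lambda>\<omega>. order_stat K X \<omega> i) \<in> borel_measurable M"
proof (rule borel_measurableI_le)
  fix y
  show "{\<omega> \<in> space M. order_stat K X \<omega> i \<le> y} \<in> sets M"
    unfolding order_stat_le_iff[OF i] by measurable
qed

lemma borel_measurable_spacing:
  assumes "\<And>j. j \<in> {1..K} \<Longrightarrow> X j \<in> borel_measurable M" and i: "i \<le> K"
  shows "(\<lambda>\<omega>. spacing K (order_stat K X \<omega>) i) \<in> borel_measurable M"
proof -
  have "(\<lambda>\<omega>. grid K (order_stat K X \<omega>) k) \<in> borel_measurable M" if "k \<le> Suc K" for k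
    using that borel_measurable_order_stat[OF assms(1), where i=k]
    by (cases "k = 0"; cases "k = Suc K") (auto simp: grid_def)
  then show ?thesis
    using i by (auto simp: spacing_eq_grid intro!: borel_measurable_diff)
qed

lemma borel_measurable_opt_path_length:
  assumes "\<And>i. i \<le> K \<Longrightarrow> (\<lambda>\<omega>. x \<omega> i) \<in> borel_measurable M"
  shows "(\<lambda>\<omega>. opt_path_length K (x \<omega>)) \<in> borel_measurable M"
  unfolding opt_path_length_def path_length_def using finite_search_trees assms
  by (intro borel_measurable_Min) auto

section \<open>Squared spacings as an area\<close>

text \<open>The open squares over the gaps lie along the diagonal, are pairwise disjoint, and have
  the squared gaps as areas.\<close>

lemma sum_gap_squares_le_area:
  fixes P :: "nat \<Rightarrow> real"
  assumes mono: "\<And>i j. i \<le> j \<Longrightarrow> j \<le> Suc K \<Longrightarrow> P i \<le> P j"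
    and A: "A \<in> sets (lborel \<Otimes>\<^sub>M lborel)"
    and sub: "\<And>i. i \<le> K \<Longrightarrow> {P i<..<P (Suc i)} \<times> {P i<..<P (Suc i)} \<subseteq> A"
  shows "ennreal (\<Sum>i=0..K. (P (Suc i) - P i)\<^sup>2) \<le> emeasure (lborel \<Otimes>\<^sub>M lborel) A"
proof -
  let ?B = "\<lambda>i. {P i<..<P (Suc i)}"
  let ?L = "lborel \<Otimes>\<^sub>M lborel :: (real \<times> real) measure"
  have disj_less: "?B i \<inter> ?B j = {}" if "i < j" "j \<le> K" for i j
    using mono[of "Suc i" j] that by auto
  have disj: "disjoint_family_on (\<lambda>i. ?B i \<times> ?B i) {0..K}"
    unfolding disjoint_family_on_def
  proof (intro ballI impI)
    fix i j assume "i \<in> {0..K}" "j \<in> {0..K}" "i \<noteq> j"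
    then have "?B i \<inter> ?B j = {}"
      using disj_less[of i j] disj_less[of j i] by (cases "i < j") auto
    then show "?B i \<times> ?B i \<inter> ?B j \<times> ?B j = {}" by blast
  qed
  have "ennreal ((P (Suc i) - P i)\<^sup>2) = emeasure ?L (?B i \<times> ?B i)" if "i \<in> {0..K}" for i
    using mono[of i "Suc i"] that
    by (subst lborel.emeasure_pair_measure_Times) (auto simp: ennreal_mult[symmetric] power2_eq_square)
  then have "ennreal (\<Sum>i=0..K. (P (Suc i) - P i)\<^sup>2) = (\<Sum>i=0..K. emeasure ?L (?B i \<times> ?B i))"
    by (subst sum_ennreal[symmetric]) auto
  also have "\<dots> = emeasure ?L (\<Union>i\<in>{0..K}. ?B i \<times> ?B i)"
    using disj by (intro sum_emeasure) auto
  also have "\<dots> \<le> emeasure ?L A"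
    using A sub by (intro emeasure_mono UN_least) auto
  finally show ?thesis .
qed

text \<open>For samples in the unit interval this is, up to a null set, the union of the diagonal
  squares over the spacings. It is phrased by the samples themselves and not by their order
  statistics, so that independence applies directly for a fixed pair.\<close>

definition avoiding_pairs :: "nat \<Rightarrow> (nat \<Rightarrow> 'a \<Rightarrow> real) \<Rightarrow> 'a \<Rightarrow> (real \<times> real) set" where
  "avoiding_pairs K X \<omega> =
    {(u, v) \<in> {0..1} \<times> {0..1}. \<forall>j\<in>{1..K}. X j \<omega> \<notin> {min u v..max u v}}"

lemma sum_spacing_squares_le_area:
  assumes X: "\<And>j. j \<in> {1..K} \<Longrightarrow> X j \<omega> \<in> {0..1}"
    and A: "avoiding_pairs K X \<omega> \<in> sets (lborel \<Otimes>\<^sub>M lborel)"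
  shows "ennreal (\<Sum>i=0..K. (spacing K (order_stat K X \<omega>) i)\<^sup>2)
    \<le> emeasure (lborel \<Otimes>\<^sub>M lborel) (avoiding_pairs K X \<omega>)"
proof -
  let ?P = "grid K (order_stat K X \<omega>)"
  have mono: "?P i \<le> ?P j" if "i \<le> j" "j \<le> Suc K" for i j
    using X that by (rule grid_order_stat_mono)
  have "{?P i<..<?P (Suc i)} \<times> {?P i<..<?P (Suc i)} \<subseteq> avoiding_pairs K X \<omega>" if i: "i \<le> K" for i
  proof (rule subrelI)
    fix u v assume "(u, v) \<in> {?P i<..<?P (Suc i)} \<times> {?P i<..<?P (Suc i)}"
    then have uv: "u \<in> {?P i<..<?P (Suc i)}" "v \<in> {?P i<..<?P (Suc i)}"
      by auto
    have "0 \<le> ?P i" "?P (Suc i) \<le> 1"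
      using mono[of 0 i] mono[of "Suc i" "Suc K"] i by (auto simp: grid_def)
    moreover have "X j \<omega> \<notin> {min u v..max u v}" if "j \<in> {1..K}" for j
    proof -
      obtain k where k: "k \<in> {1..K}" "X j \<omega> = ?P k"
        using order_stat_surj[OF \<open>j \<in> {1..K}\<close>, of X \<omega>] by (auto simp: grid_def)
      \<comment> \<open>Every sample is a grid point, and no grid point lies strictly between two
        consecutive ones.\<close>
      have "?P k \<le> ?P i \<or> ?P (Suc i) \<le> ?P k"
        using mono[of k i] mono[of "Suc i" k] i k by (cases "k \<le> i") auto
      with k uv show ?thesis by auto
    qed
    ultimately show "(u, v) \<in> avoiding_pairs K X \<omega>"
      unfolding avoiding_pairs_def using uv by auto
  qed
  then have "ennreal (\<Sum>i=0..K. (?P (Suc i) - ?P i)\<^sup>2) \<le> emeasure (lborel \<Otimes>\<^sub>M lborel) (avoiding_pairs K X \<omega>)"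
    by (intro sum_gap_squares_le_area mono A)
  moreover have "(\<Sum>i=0..K. (?P (Suc i) - ?P i)\<^sup>2) = (\<Sum>i=0..K. (spacing K (order_stat K X \<omega>) i)\<^sup>2)"
    by (intro sum.cong) (auto simp: spacing_eq_grid)
  ultimately show ?thesis by simp
qed

section \<open>Expected sum of squared spacings\<close>

lemma (in prob_space) prob_avoid_interval:
  fixes X :: "nat \<Rightarrow> 'a \<Rightarrow> real"
  assumes indep: "indep_vars (\<lambda>_. borel) X {1..K}"
    and unif: "\<And>j. j \<in> {1..K} \<Longrightarrow> distr M borel (X j) = uniform_measure lborel {0..1}"
    and ab: "0 \<le> a" "a \<le> b" "b \<le> 1"
  shows "prob {\<omega> \<in> space M. \<forall>j\<in>{1..K}. X j \<omega> \<notin> {a..b}} = (1 - (b - a)) ^ K"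
\<comment> \<open>Without samples the intersection below would run over an empty index set and not
  yield \<open>space M\<close>.\<close>
proof (cases "K = 0")
  case True
  then show ?thesis by (simp add: prob_space)
next
  case False
  have meas: "X j \<in> borel_measurable M" if "j \<in> {1..K}" for j
    using indep that by (auto simp: indep_vars_def)
  have single: "prob (X j -` (- {a..b}) \<inter> space M) = 1 - (b - a)" if j: "j \<in> {1..K}" for j
  proof -
    have "prob (X j -` (- {a..b}) \<inter> space M) = measure (uniform_measure lborel {0..1}) (- {a..b})"
      using meas[OF j] by (simp add: unif[OF j, symmetric] measure_distr)
    also have "\<dots> = measure lborel ({0..1} - {a..b})"
      by (subst measure_uniform_measure) (auto simp: Diff_eq)
    also have "\<dots> = 1 - (b - a)"
      using ab by (subst measure_Diff) auto
    finally show ?thesis .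
  qed
  have "{\<omega> \<in> space M. \<forall>j\<in>{1..K}. X j \<omega> \<notin> {a..b}} = (\<Inter>j\<in>{1..K}. X j -` (- {a..b}) \<inter> space M)"
    using False by auto
  then have "prob {\<omega> \<in> space M. \<forall>j\<in>{1..K}. X j \<omega> \<notin> {a..b}}
      = (\<Prod>j\<in>{1..K}. prob (X j -` (- {a..b}) \<inter> space M))"
    using False by (simp only:) (intro indep_varsD[OF indep], auto)
  also have "\<dots> = (1 - (b - a)) ^ K"
    by (simp add: single)
  finally show ?thesis .
qed

text \<open>Splitting at \<open>v = u\<close> removes the absolute value, and each half integrates
  to at most \<open>1 / (real K + 1)\<close>.\<close>

lemma nn_integral_distance_power_le:
  fixes u :: real
  assumes u: "u \<in> {0..1}"
  shows "(\<integral>\<^sup>+v. ennreal ((1 - \<bar>u - v\<bar>) ^ K) * indicator {0..1} v \<partial>lborel) \<le> ennreal (2 / (real K + 1))"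
proof -
  have left: "(\<integral>\<^sup>+v. ennreal ((1 - u + v) ^ K) * indicator {0..u} v \<partial>lborel)
      = ennreal ((1 - u + u) ^ Suc K / (real K + 1) - (1 - u + 0) ^ Suc K / (real K + 1))"
    using u by (intro nn_integral_FTC_Icc) (auto intro!: derivative_eq_intros simp: add_nonneg_eq_0_iff add_ac simp del: power_Suc)
  have right: "(\<integral>\<^sup>+v. ennreal ((1 + u - v) ^ K) * indicator {u..1} v \<partial>lborel)
      = ennreal (- ((1 + u - 1) ^ Suc K / (real K + 1)) - - ((1 + u - u) ^ Suc K / (real K + 1)))"
    using u by (intro nn_integral_FTC_Icc) (auto intro!: derivative_eq_intros simp: add_nonneg_eq_0_iff add_ac simp del: power_Suc)
  \<comment> \<open>The two closed pieces overlap at \<open>v = u\<close>, so pointwise there is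
    only an inequality.\<close>
  have "(\<integral>\<^sup>+v. ennreal ((1 - \<bar>u - v\<bar>) ^ K) * indicator {0..1} v \<partial>lborel)
      \<le> (\<integral>\<^sup>+v. ennreal ((1 - u + v) ^ K) * indicator {0..u} v
              + ennreal ((1 + u - v) ^ K) * indicator {u..1} v \<partial>lborel)"
    by (intro nn_integral_mono) (auto simp: indicator_def abs_if algebra_simps)
  also have "\<dots> = (\<integral>\<^sup>+v. ennreal ((1 - u + v) ^ K) * indicator {0..u} v \<partial>lborel)
              + (\<integral>\<^sup>+v. ennreal ((1 + u - v) ^ K) * indicator {u..1} v \<partial>lborel)"
    by (intro nn_integral_add) auto
  also have "\<dots> \<le> ennreal (1 / (real K + 1)) + ennreal (1 / (real K + 1))"
    unfolding left right using u by (intro add_mono ennreal_leI) auto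
  also have "\<dots> = ennreal (2 / (real K + 1))"
    by (simp add: ennreal_plus[symmetric] del: ennreal_plus)
  finally show ?thesis .
qed

text \<open>The expected area is, by Tonelli, the integral over the pairs \<open>(u, v)\<close> of
  the probability that no sample falls between them.\<close>

lemma (in prob_space) nn_integral_sum_spacing_squares_le:
  fixes X :: "nat \<Rightarrow> 'a \<Rightarrow> real"
  assumes indep: "indep_vars (\<lambda>_. borel) X {1..K}"
    and unif: "\<And>j. j \<in> {1..K} \<Longrightarrow> distr M borel (X j) = uniform_measure lborel {0..1}"
    and ran: "AE \<omega> in M. \<forall>j\<in>{1..K}. X j \<omega> \<in> {0..1}"
  shows "(\<integral>\<^sup>+\<omega>. ennreal (\<Sum>i=0..K. (spacing K (order_stat K X \<omega>) i)\<^sup>2) \<partial>M)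
    \<le> ennreal (2 / (real K + 1))"
proof -
  let ?L = "lborel \<Otimes>\<^sub>M lborel :: (real \<times> real) measure"
  interpret prod: pair_sigma_finite M ?L
    by (intro pair_sigma_finite.intro sigma_finite_pair_measure
        lborel.sigma_finite_measure_axioms sigma_finite_measure_axioms)
  have meas[measurable]: "X j \<in> borel_measurable M" if "j \<in> {1..K}" for j
    using indep that by (auto simp: indep_vars_def)
  \<comment> \<open>Tonelli requires measurability jointly in the outcome and the pair;
    measurability of the sections follows from it.\<close>
  have pred: "Measurable.pred (M \<Otimes>\<^sub>M ?L) (\<lambda>(\<omega>, z). z \<in> avoiding_pairs K X \<omega>)"
  proof -
    have "Measurable.pred (M \<Otimes>\<^sub>M ?L) (\<lambda>x. (fst (snd x) \<in> {0..1} \<and> snd (snd x) \<in> {0..1})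
      \<and> (\<forall>j\<in>{1..K}. \<not> (min (fst (snd x)) (snd (snd x)) \<le> X j (fst x)
          \<and> X j (fst x) \<le> max (fst (snd x)) (snd (snd x)))))"
      by measurable
    then show ?thesis
      by (rule iffD1[OF measurable_cong, rotated]) (auto simp: avoiding_pairs_def)
  qed
  have ind: "(\<lambda>(\<omega>, z). indicator (avoiding_pairs K X \<omega>) z :: ennreal) \<in> borel_measurable (M \<Otimes>\<^sub>M ?L)"
    using pred by (auto simp: indicator_def case_prod_beta' cong: measurable_cong intro!: measurable_If)
  have swapped: "(\<lambda>(z, \<omega>). indicator (avoiding_pairs K X \<omega>) z :: ennreal) \<in> borel_measurable (?L \<Otimes>\<^sub>M M)"
    using measurable_pair_swap[OF ind] by (simp add: case_prod_beta')
  have sec: "avoiding_pairs K X \<omega> \<in> sets ?L" if "\<omega> \<in> space M" for \<omega>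
  proof -
    have "Measurable.pred ?L (\<lambda>z. z \<in> avoiding_pairs K X \<omega>)"
      using measurable_compose[OF measurable_Pair1'[OF that] pred] by simp
    then show ?thesis
      by (simp add: pred_def space_pair_measure)
  qed
  have "(\<integral>\<^sup>+\<omega>. ennreal (\<Sum>i=0..K. (spacing K (order_stat K X \<omega>) i)\<^sup>2) \<partial>M)
      \<le> (\<integral>\<^sup>+\<omega>. emeasure ?L (avoiding_pairs K X \<omega>) \<partial>M)"
    using ran AE_space
    by (intro nn_integral_mono_AE, eventually_elim) (intro sum_spacing_squares_le_area sec, auto)
  also have "\<dots> = (\<integral>\<^sup>+\<omega>. (\<integral>\<^sup>+z. indicator (avoiding_pairs K X \<omega>) z \<partial>?L) \<partial>M)"
    using sec by (intro nn_integral_cong) simp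
  also have "\<dots> = (\<integral>\<^sup>+z. (\<integral>\<^sup>+\<omega>. indicator (avoiding_pairs K X \<omega>) z \<partial>M) \<partial>?L)"
    using prod.Fubini'[OF ind] by simp
  also have "\<dots> = (\<integral>\<^sup>+u. (\<integral>\<^sup>+v. (\<integral>\<^sup>+\<omega>. indicator (avoiding_pairs K X \<omega>) (u, v) \<partial>M) \<partial>lborel) \<partial>lborel)"
    using borel_measurable_nn_integral[OF swapped]
    by (subst lborel.nn_integral_fst[symmetric]) simp_all
  also have "\<dots> \<le> (\<integral>\<^sup>+u. ennreal (2 / (real K + 1)) * indicator {0..1::real} u \<partial>lborel)"
  proof (intro nn_integral_mono)
    fix u :: real
    \<comment> \<open>The two indicators confine the pair to the unit square; the one in
      \<open>u\<close> restricts the outer integral to length 1.\<close>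
    have inner: "(\<integral>\<^sup>+\<omega>. indicator (avoiding_pairs K X \<omega>) (u, v) \<partial>M)
        = ennreal ((1 - \<bar>u - v\<bar>) ^ K) * indicator {0..1} v * indicator {0..1} u" for v
    proof (cases "u \<in> {0..1} \<and> v \<in> {0..1}")
      case True
      let ?S = "{\<omega> \<in> space M. \<forall>j\<in>{1..K}. X j \<omega> \<notin> {min u v..max u v}}"
      have "?S \<in> sets M" by measurable
      have "(\<integral>\<^sup>+\<omega>. indicator (avoiding_pairs K X \<omega>) (u, v) \<partial>M) = (\<integral>\<^sup>+\<omega>. indicator ?S \<omega> \<partial>M)"
        using True by (intro nn_integral_cong) (auto simp: avoiding_pairs_def indicator_def)
      also have "\<dots> = emeasure M ?S"
        using \<open>?S \<in> sets M\<close> by (rule nn_integral_indicator)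
      also have "\<dots> = ennreal ((1 - (max u v - min u v)) ^ K)"
        using True by (subst emeasure_eq_measure, subst prob_avoid_interval[OF indep unif]) auto
      also have "max u v - min u v = \<bar>u - v\<bar>" by auto
      finally show ?thesis using True by simp
    next
      case False
      then have "(u, v) \<notin> avoiding_pairs K X \<omega>" for \<omega>
        by (auto simp: avoiding_pairs_def)
      with False show ?thesis by auto
    qed
    show "(\<integral>\<^sup>+v. (\<integral>\<^sup>+\<omega>. indicator (avoiding_pairs K X \<omega>) (u, v) \<partial>M) \<partial>lborel)
        \<le> ennreal (2 / (real K + 1)) * indicator {0..1} u"
      unfolding inner using nn_integral_distance_power_le[of u K]
      by (cases "u \<in> {0..1}") auto
  qed
  also have "\<dots> = ennreal (2 / (real K + 1))"
    by (simp add: nn_integral_cmult_indicator)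
  finally show ?thesis .
qed

section \<open>Bounds on the expectation, and the limit\<close>

lemma (in prob_space) expectation_opt_path_length_bounds:
  fixes X :: "nat \<Rightarrow> 'a \<Rightarrow> real"
  assumes indep: "indep_vars (\<lambda>_. borel) X {1..K}"
    and unif: "\<And>j. j \<in> {1..K} \<Longrightarrow> distr M borel (X j) = uniform_measure lborel {0..1}"
  shows "ln ((real K + 1) / 2) / ln 2 \<le> gamma_opt M X K"
    and "gamma_opt M X K \<le> ln (real K + 1) / ln 2 + 1"
proof -
  let ?D = "\<lambda>\<omega>. spacing K (order_stat K X \<omega>)"
  let ?Q = "\<lambda>\<omega>. \<Sum>i=0..K. (?D \<omega> i)\<^sup>2"
  have meas: "X j \<in> borel_measurable M" if "j \<in> {1..K}" for j
    using indep that by (auto simp: indep_vars_def)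
  have "AE \<omega> in M. X j \<omega> \<in> {0..1}" if j: "j \<in> {1..K}" for j
  proof -
    have "AE x in distr M borel (X j). x \<in> {0..1}"
      unfolding unif[OF j] by (rule AE_uniform_measureI) auto
    then show ?thesis
      using meas[OF j] by (subst (asm) AE_distr_iff) auto
  qed
  then have ran: "AE \<omega> in M. \<forall>j\<in>{1..K}. X j \<omega> \<in> {0..1}"
    by (intro AE_finite_allI) auto
  have pos: "0 \<le> ?D \<omega> i" if "\<forall>j\<in>{1..K}. X j \<omega> \<in> {0..1}" "i \<le> K" for \<omega> i
    using grid_order_stat_mono[of K X \<omega> i "Suc i"] that by (simp add: spacing_eq_grid)
  have D_meas: "(\<lambda>\<omega>. ?D \<omega> i) \<in> borel_measurable M" if "i \<le> K" for i
    using that by (intro borel_measurable_spacing meas)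
  have opt_meas: "(\<lambda>\<omega>. opt_path_length K (?D \<omega>)) \<in> borel_measurable M"
    by (intro borel_measurable_opt_path_length D_meas)
  have bound: "AE \<omega> in M. 0 \<le> opt_path_length K (?D \<omega>) \<and> opt_path_length K (?D \<omega>) \<le> real h"
    if "K < 2 ^ h" for h
    using ran by eventually_elim
      (use that pos in \<open>auto intro!: opt_path_length_nonneg opt_path_length_le simp: sum_spacing\<close>)
  \<comment> \<open>The crude height \<open>h = K\<close>, admissible since
    \<open>K < 2 ^ K\<close>, already gives integrability.\<close>
  have int: "integrable M (\<lambda>\<omega>. opt_path_length K (?D \<omega>))"
    using bound[OF less_exp] opt_meas
    by (intro integrable_const_bound[where B="real K"]) auto
  \<comment> \<open>The least height with \<open>K < 2 ^ h\<close>; rounding up costs at most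
    1.\<close>
  define h where "h = nat \<lceil>log 2 (real K + 1)\<rceil>"
  have h: "log 2 (real K + 1) \<le> real h" "real h \<le> log 2 (real K + 1) + 1"
    unfolding h_def by (auto simp: of_nat_nat)
  have "real K + 1 \<le> 2 ^ h"
    using h(1) by (simp add: log_le_iff powr_realpow)
  then have "real K < 2 ^ h" by linarith
  then have "K < 2 ^ h" by simp
  then have "expectation (\<lambda>\<omega>. opt_path_length K (?D \<omega>)) \<le> expectation (\<lambda>_. real h)"
    using bound[of h] by (intro integral_mono_AE int) auto
  also have "\<dots> \<le> ln (real K + 1) / ln 2 + 1"
    using h(2) by (simp add: prob_space log_def)
  finally show "gamma_opt M X K \<le> ln (real K + 1) / ln 2 + 1"
    by (simp add: gamma_opt_def)

  have Q: "(\<integral>\<^sup>+\<omega>. ennreal (?Q \<omega>) \<partial>M) \<le> ennreal (2 / (real K + 1))"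
    by (rule nn_integral_sum_spacing_squares_le[OF indep unif ran])
  have Q_meas: "?Q \<in> borel_measurable M"
    using D_meas by (intro borel_measurable_sum borel_measurable_power) auto
  have Q_int: "integrable M ?Q"
    using Q Q_meas by (intro integrableI_nonneg) (auto intro!: sum_nonneg simp: less_top[symmetric] top_unique)
  have Q_le: "expectation ?Q \<le> 2 / (real K + 1)"
    using Q Q_meas by (subst integral_eq_nn_integral) (auto intro!: sum_nonneg enn2real_leI)
  \<comment> \<open>The reciprocal of the bound on the expectation of \<open>?Q\<close>, so the
    subtracted term is at most 1 and the summand 1 absorbs it.\<close>
  let ?a = "(real K + 1) / 2"
  have "ln ?a \<le> ln ?a + 1 - ?a * expectation ?Q"
    using Q_le by (simp add: field_simps)
  also have "\<dots> = expectation (\<lambda>\<omega>. ln ?a + 1 - ?a * ?Q \<omega>)"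
    using Q_int by (simp add: prob_space)
  also have "\<dots> \<le> expectation (\<lambda>\<omega>. ln 2 * opt_path_length K (?D \<omega>))"
  proof (intro integral_mono_AE)
    show "AE \<omega> in M. ln ?a + 1 - ?a * ?Q \<omega> \<le> ln 2 * opt_path_length K (?D \<omega>)"
      using ran by eventually_elim (intro opt_path_length_ge sum_spacing pos, auto)
  qed (use Q_int int in auto)
  also have "\<dots> = ln 2 * gamma_opt M X K"
    by (simp add: gamma_opt_def)
  finally show "ln ((real K + 1) / 2) / ln 2 \<le> gamma_opt M X K"
    by (simp add: field_simps)
qed

text \<open>Harmonic numbers differ from the logarithm by a convergent sequence, and bounded terms
  vanish after division by \<open>L K\<close>. The constant \<open>c\<close> is arbitrary so that
  one limit serves both sides of the sandwich.\<close>

lemma ln_over_harm_tendsto: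
  "(\<lambda>K. (ln (real K + 1) + c) / (harm (K + 1) - 1)) \<longlonglongrightarrow> 1"
proof -
  define L where "L K = ln (real K + 1)" for K :: nat
  define e where "e K = harm (K + 1) - L K" for K
  have "(\<lambda>K. harm (Suc K) - ln (real (Suc K)) :: real) \<longlonglongrightarrow> euler_mascheroni"
    by (rule LIMSEQ_Suc[OF euler_mascheroni_LIMSEQ])
  then have e: "e \<longlonglongrightarrow> euler_mascheroni"
    by (simp add: e_def[abs_def] L_def add.commute)
  have L: "filterlim L at_top sequentially"
    unfolding L_def add.commute[of _ 1]
    by (intro filterlim_compose[OF ln_at_top] filterlim_tendsto_add_at_top[OF tendsto_const]
        filterlim_real_sequentially)
  have "(\<lambda>K. (1 + c / L K) / (1 + (e K - 1) / L K)) \<longlonglongrightarrow> (1 + 0) / (1 + 0)"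
    by (intro tendsto_intros tendsto_divide_0[OF tendsto_const]
        tendsto_divide_0[OF tendsto_diff[OF e tendsto_const]] filterlim_at_top_imp_at_infinity L) simp
  moreover have "\<forall>\<^sub>F K in sequentially.
      (1 + c / L K) / (1 + (e K - 1) / L K) = (L K + c) / (harm (K + 1) - 1)"
    \<comment> \<open>Cancelling \<open>L K\<close> needs it to be positive, which fails at
      \<open>K = 0\<close>.\<close>
    using filterlim_at_top_dense[THEN iffD1, OF L, rule_format, of 0]
  proof eventually_elim
    case (elim K)
    have "1 + c / L K = (L K + c) / L K" "1 + (e K - 1) / L K = (harm (K + 1) - 1) / L K"
      using elim by (auto simp: e_def field_simps)
    then show ?case using elim by simp
  qed
  ultimately show ?thesis
    unfolding L_def by (simp add: tendsto_cong)
qed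

theorem theorem2:
  fixes M :: "nat \<Rightarrow> 'a measure" and X :: "nat \<Rightarrow> nat \<Rightarrow> 'a \<Rightarrow> real"
  assumes "\<And>K. prob_space (M K)"
    and "\<And>K. prob_space.indep_vars (M K) (\<lambda>_. borel) (X K) {1..K}"
    and "\<And>K i. i \<in> {1..K} \<Longrightarrow> distr (M K) borel (X K i) = uniform_measure lborel {0..1}"
  shows "(\<lambda>K. alpha_opt (M K) (X K) K) \<longlonglongrightarrow> 1 / ln 2"
proof (rule tendsto_sandwich)
  note bounds = prob_space.expectation_opt_path_length_bounds[OF assms]
  \<comment> \<open>At \<open>K = 0\<close> the difference is 0 and division by it yields 0, so
    nonnegativity suffices to divide the bounds for every \<open>K\<close>.\<close>
  have harm: "0 \<le> harm (K + 1) - (1::real)" for K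
    using harm_mono[of 1 "K + 1", where ?'a=real] by (simp add: harm_def)
  \<comment> \<open>Both bounds are brought to the form \<open>(ln (real K + 1) + c) / ln 2\<close>,
    here with \<open>c = - ln 2\<close> and below with \<open>c = ln 2\<close>.\<close>
  have lower: "(ln (real K + 1) + (- ln 2)) / ln 2 \<le> gamma_opt (M K) (X K) K" for K
    using bounds(1)[of K] by (simp add: ln_div)
  have upper: "gamma_opt (M K) (X K) K \<le> (ln (real K + 1) + ln 2) / ln 2" for K
    using bounds(2)[of K] by (simp add: add_divide_distrib)
  show "\<forall>\<^sub>F K in sequentially.
      (ln (real K + 1) + (- ln 2)) / ln 2 / (harm (K + 1) - 1) \<le> alpha_opt (M K) (X K) K"
    unfolding alpha_opt_def by (intro always_eventually allI divide_right_mono lower harm)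
  show "\<forall>\<^sub>F K in sequentially.
      alpha_opt (M K) (X K) K \<le> (ln (real K + 1) + ln 2) / ln 2 / (harm (K + 1) - 1)"
    unfolding alpha_opt_def by (intro always_eventually allI divide_right_mono upper harm)
  have "(\<lambda>K. (ln (real K + 1) + c) / ln 2 / (harm (K + 1) - 1)) \<longlonglongrightarrow> 1 / ln 2" for c
    using tendsto_divide[OF ln_over_harm_tendsto[of c] tendsto_const[of "ln 2"]]
    by (simp add: mult.commute)
  then show "(\<lambda>K. (ln (real K + 1) + (- ln 2)) / ln 2 / (harm (K + 1) - 1)) \<longlonglongrightarrow> 1 / ln 2"
    "(\<lambda>K. (ln (real K + 1) + ln 2) / ln 2 / (harm (K + 1) - 1)) \<longlonglongrightarrow> 1 / ln 2"
    by blast+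
qed

end
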